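(* Let $G=G(A,B)$ be a finite bipartite graph with bipartition $(A,B)$ and $|A|=|B|$, and let $H$ be an $r$-regular finite bipartite graph. Then $$mp_f(G\square H)=\min\left\{\left.\frac{e(X,Y)+r\min\{|X|,|Y|\}}{|X|+|Y|-|A|}\ \right|\ X\subseteq A,\ Y\subseteq B,\ |X|+|Y|-|A|>0\right\}.$$
   Context: $e(X,Y)$ is the number of edges of $G$ with one end in $X$ and the other in $Y$. The Cartesian product $G\square H$ has vertex set $V(G)\times V(H)$, with $(g,h)$ and $(g',h')$ adjacent iff either $g=g'$ and $hh'\in E(H)$, or $gg'\in E(G)$ and $h=h'$. For a graph $\Gamma$, let $\mathcal{M}(\Gamma)$ be its set of perfect matchings and $\bm{q}^M\in\mathbb{R}^{E(\Gamma)}$ the incidence vector of $M$; the fractional matching preclusion number $mp_f(\Gamma)$ is the optimal value of the linear program: minimize $\bm{1}^T\bm{y}$ over $\bm{y}\in\mathbb{R}^{E(\Gamma)}$ subject to $(\bm{q}^M)^T\bm{y}\geqslant 1$ for every $M\in\mathcal{M}(\Gamma)$ and $\bm{y}\geqslant 0$. *)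

theory Defs
  imports Complex_Main
begin

text \<open>A graph is given by its vertex set and its edge set; edges are two-element sets of vertices.\<close>

definition fin_graph :: "'a set \<Rightarrow> 'a set set \<Rightarrow> bool" where
  "fin_graph V E \<longleftrightarrow> finite V \<and> (\<forall>e\<in>E. \<exists>u\<in>V. \<exists>v\<in>V. u \<noteq> v \<and> e = {u, v})"

definition bipartition :: "'a set \<Rightarrow> 'a set set \<Rightarrow> 'a set \<Rightarrow> 'a set \<Rightarrow> bool" where
  "bipartition V E A B \<longleftrightarrow>
     A \<union> B = V \<and> A \<inter> B = {} \<and> (\<forall>e\<in>E. \<exists>a\<in>A. \<exists>b\<in>B. e = {a, b})"

definition bipartite :: "'a set \<Rightarrow> 'a set set \<Rightarrow> bool" where
  "bipartite V E \<longleftrightarrow> (\<exists>A B. bipartition V E A B)"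

definition regular :: "nat \<Rightarrow> 'a set \<Rightarrow> 'a set set \<Rightarrow> bool" where
  "regular r V E \<longleftrightarrow> (\<forall>v\<in>V. card {e \<in> E. v \<in> e} = r)"

definition edges_between :: "'a set set \<Rightarrow> 'a set \<Rightarrow> 'a set \<Rightarrow> nat" where
  "edges_between E X Y = card {e \<in> E. \<exists>x\<in>X. \<exists>y\<in>Y. e = {x, y}}"

definition cart_edges ::
  "'a set \<Rightarrow> 'a set set \<Rightarrow> 'b set \<Rightarrow> 'b set set \<Rightarrow> ('a \<times> 'b) set set" where
  "cart_edges V E W F =
     {{(g, h), (g', h')} | g h g' h'.
        (g, h) \<in> V \<times> W \<and> (g', h') \<in> V \<times> W \<and>
        (g = g' \<and> {h, h'} \<in> F \<or> {g, g'} \<in> E \<and> h = h')}"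

definition perfect_matchings :: "'a set \<Rightarrow> 'a set set \<Rightarrow> 'a set set set" where
  "perfect_matchings V E = {M. M \<subseteq> E \<and> (\<forall>v\<in>V. \<exists>!e. e \<in> M \<and> v \<in> e)}"

definition incidence :: "'e set \<Rightarrow> 'e \<Rightarrow> real" where
  "incidence M e = (if e \<in> M then 1 else 0)"

text \<open>Vectors indexed by the edge set are functions on edges, of which only the values on
  \<^term>\<open>E\<close> are used.\<close>

definition mp_feasible :: "'a set \<Rightarrow> 'a set set \<Rightarrow> ('a set \<Rightarrow> real) \<Rightarrow> bool" where
  "mp_feasible V E y \<longleftrightarrow>
     (\<forall>M \<in> perfect_matchings V E. (\<Sum>e\<in>E. incidence M e * y e) \<ge> 1) \<and> (\<forall>e\<in>E. y e \<ge> 0)"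

text \<open>If \<^term>\<open>V\<close> is empty, the empty set is a perfect matching, the program is
  infeasible and the value below is unspecified; for every other finite graph the program is
  feasible and bounded below by 0.\<close>

definition mp_f :: "'a set \<Rightarrow> 'a set set \<Rightarrow> real" where
  "mp_f V E = Inf {(\<Sum>e\<in>E. y e) | y. mp_feasible V E y}"

end

theory Submission
  imports Defs
begin

text \<open>By linear programming duality, a lower bound \<open>t\<close> for the fractional matching preclusion number
  of a bipartite graph is certified by an edge weighting with values in \<open>[0, 1]\<close> and all weighted
  degrees equal to \<open>t\<close>, because such a weighting is a combination of perfect matchings of total
  coefficient \<open>t\<close> (Birkhoff). On the product such a weighting can be chosen constant on
  copies of each edge of \<open>G\<close> and on each copy of \<open>H\<close>; it then exists as soon as \<open>G\<close> has a
  weighting in \<open>[0, 1]\<close> with degrees between \<open>t - r\<close> and \<open>t\<close>. Hoffman's circulation theorem says that the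
  only obstructions to this are the cuts \<open>(X, Y)\<close> occurring in the formula, and every such cut
  gives a feasible point of the program with the corresponding value. Applied
  over the integers, Hoffman's theorem also provides the perfect matchings for Birkhoff's theorem.

  Hoffman's theorem is proved by fixing the flow on one arc after the other. The cuts that bound the
  value on an arc from below are compatible with those that bound it from above by
  uncrossing.\<close>

section \<open>Hoffman's circulation theorem\<close>

text \<open>Nonnegativity for all \<open>U\<close> is Hoffman's condition: the arcs leaving
  \<open>U\<close> have room for whatever the lower bounds force into \<open>U\<close>. With
  \<open>l = u\<close> the value is the net outflow of \<open>U\<close>.\<close>

definition cut_slack ::
  "('v \<times> 'v) set \<Rightarrow> ('v \<times> 'v \<Rightarrow> 'c) \<Rightarrow> ('v \<times> 'v \<Rightarrow> 'c) \<Rightarrow> 'v set \<Rightarrow> 'c::linordered_ab_group_add" where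
  "cut_slack D l u U =
     (\<Sum>e\<in>D. if fst e \<in> U \<and> snd e \<notin> U then u e
            else if fst e \<notin> U \<and> snd e \<in> U then - l e else 0)"

lemma cut_slack_remove:
  assumes "finite D" "e \<in> D"
  shows "cut_slack D l u U =
    (if fst e \<in> U \<and> snd e \<notin> U then u e
     else if fst e \<notin> U \<and> snd e \<in> U then - l e else 0) + cut_slack (D - {e}) l u U"
  unfolding cut_slack_def using assms by (simp add: sum.remove)

text \<open>Arc by arc, both sides agree except on an arc between \<open>U - U'\<close> and
  \<open>U' - U\<close>, in either direction: it crosses neither the intersection nor the union, but
  adds \<open>u e - l e\<close> on the right.\<close>

lemma cut_slack_submodular:
  assumes "\<And>e. e \<in> D \<Longrightarrow> l e \<le> u e"
  shows "cut_slack D l u (U \<inter> U') + cut_slack D l u (U \<union> U')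
    \<le> cut_slack D l u U + cut_slack D l u U'"
  unfolding cut_slack_def sum.distrib[symmetric]
proof (rule sum_mono)
  fix e assume "e \<in> D"
  then show "(if fst e \<in> U \<inter> U' \<and> snd e \<notin> U \<inter> U' then u e
       else if fst e \<notin> U \<inter> U' \<and> snd e \<in> U \<inter> U' then - l e else 0) +
      (if fst e \<in> U \<union> U' \<and> snd e \<notin> U \<union> U' then u e
       else if fst e \<notin> U \<union> U' \<and> snd e \<in> U \<union> U' then - l e else 0)
      \<le> (if fst e \<in> U \<and> snd e \<notin> U then u e
          else if fst e \<notin> U \<and> snd e \<in> U then - l e else 0) +
        (if fst e \<in> U' \<and> snd e \<notin> U' then u e
          else if fst e \<notin> U' \<and> snd e \<in> U' then - l e else 0)"
    using assms[of e] by (cases "fst e \<in> U"; cases "fst e \<in> U'"; cases "snd e \<in> U"; cases "snd e \<in> U'") auto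
qed

lemma cut_slack_fix_arc:
  fixes l u :: "'v \<times> 'v \<Rightarrow> 'c::{linordered_ab_group_add, conditionally_complete_linorder}"
  assumes fin: "finite D" and e: "e \<in> D" and lu: "\<And>e. e \<in> D \<Longrightarrow> l e \<le> u e"
    and cut: "\<And>U. 0 \<le> cut_slack D l u U"
  obtains c where "l e \<le> c" "c \<le> u e" "\<And>U. 0 \<le> cut_slack D (l(e := c)) (u(e := c)) U"
proof -
  define R where "R = cut_slack (D - {e}) l u"
  have slack: "cut_slack D l u U =
     (if fst e \<in> U \<and> snd e \<notin> U then u e
      else if fst e \<notin> U \<and> snd e \<in> U then - l e else 0) + R U" for U
    unfolding R_def using fin e by (rule cut_slack_remove)
  \<comment> \<open>\<open>L\<close> collects the lower bounds on the new value \<open>c\<close>: a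
    cut that \<open>e\<close> leaves demands \<open>- R U \<le> c\<close>, one that \<open>e\<close>
    enters demands \<open>c \<le> R U\<close>. By \<open>u1\<close> and \<open>u2\<close>, every
    member of \<open>L\<close> is below every upper bound, so the supremum satisfies all
    demands.\<close>
  define L where "L = insert (l e) {- R U | U. fst e \<in> U \<and> snd e \<notin> U}"
  define c where "c = Sup L"
  have u1: "x \<le> u e" if "x \<in> L" for x
  proof -
    have "- R U \<le> u e" if "fst e \<in> U" "snd e \<notin> U" for U
      using cut[of U] slack[of U] that by simp (metis diff_ge_0_iff_ge diff_minus_eq_add)
    then show ?thesis using that lu[OF e] unfolding L_def by auto
  qed
  have u2: "x \<le> R U" if "x \<in> L" and U: "fst e \<notin> U" "snd e \<in> U" for x U
  proof -
    have "l e \<le> R U" using cut[of U] slack[of U] U by simp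
    moreover have "- R U' \<le> R U" if U': "fst e \<in> U'" "snd e \<notin> U'" for U'
    proof -
      \<comment> \<open>Uncrossing: \<open>e\<close> runs from \<open>U' - U\<close> to
        \<open>U - U'\<close>, so it crosses neither the intersection nor the union, and their
        slacks come from the other arcs alone.\<close>
      have "0 \<le> cut_slack D l u (U \<inter> U') + cut_slack D l u (U \<union> U')"
        using cut add_nonneg_nonneg by blast
      also have "\<dots> = R (U \<inter> U') + R (U \<union> U')"
        unfolding slack using U U' by simp
      also have "\<dots> \<le> R U + R U'"
        unfolding R_def by (rule cut_slack_submodular) (use lu in auto)
      finally show ?thesis by (metis diff_ge_0_iff_ge diff_minus_eq_add)
    qed
    ultimately show ?thesis using that unfolding L_def by auto
  qed
  have bdd: "bdd_above L" using u1 by (rule bdd_aboveI)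
  have ne: "L \<noteq> {}" unfolding L_def by simp
  have c1: "x \<le> c" if "x \<in> L" for x
    unfolding c_def using that bdd by (rule cSup_upper)
  have rest: "cut_slack (D - {e}) (l(e := c)) (u(e := c)) U = R U" for U
    unfolding R_def cut_slack_def by (rule sum.cong) auto
  show ?thesis
  proof
    show "l e \<le> c" by (rule c1) (simp add: L_def)
    show "c \<le> u e" unfolding c_def using ne u1 by (rule cSup_least)
    fix U
    have eq: "cut_slack D (l(e := c)) (u(e := c)) U =
      (if fst e \<in> U \<and> snd e \<notin> U then c
      else if fst e \<notin> U \<and> snd e \<in> U then - c else 0) + R U"
      using cut_slack_remove[OF fin e, of "l(e := c)" "u(e := c)" U] rest by simp
    show "0 \<le> cut_slack D (l(e := c)) (u(e := c)) U"
    proof (cases "fst e \<in> U \<and> snd e \<notin> U")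
      case True
      then have "- R U \<le> c" by (intro c1) (auto simp: L_def)
      then show ?thesis using True eq by simp (metis diff_ge_0_iff_ge diff_minus_eq_add)
    next
      case False
      show ?thesis
      proof (cases "fst e \<notin> U \<and> snd e \<in> U")
        case True
        then have "c \<le> R U" unfolding c_def using ne u2 by (intro cSup_least) auto
        then show ?thesis using True eq by simp
      next
        case F2: False
        then show ?thesis using eq slack[of U] cut[of U] False by auto
      qed
    qed
  qed
qed

text \<open>Stated over an arbitrary complete ordered group so that it yields real circulations as well
  as integral ones.\<close>

theorem hoffman_circulation:
  fixes l u :: "'v \<times> 'v \<Rightarrow> 'c::{linordered_ab_group_add, conditionally_complete_linorder}"
  assumes fin: "finite D" and lu: "\<And>e. e \<in> D \<Longrightarrow> l e \<le> u e"
    and cut: "\<And>U. 0 \<le> cut_slack D l u U"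
  shows "\<exists>f. (\<forall>e\<in>D. l e \<le> f e \<and> f e \<le> u e) \<and>
    (\<forall>v. (\<Sum>e | e \<in> D \<and> fst e = v. f e) = (\<Sum>e | e \<in> D \<and> snd e = v. f e))"
proof -
  \<comment> \<open>\<open>K\<close> holds the arcs whose value is still open. The bounds vary in
    the induction because each step replaces those on one arc by a single value; once
    \<open>K\<close> is empty, \<open>l\<close> itself is the flow.\<close>
  have "\<exists>f. (\<forall>e\<in>D. l e \<le> f e \<and> f e \<le> u e) \<and> (\<forall>U. 0 \<le> cut_slack D f f U)"
    if "finite K" "K \<subseteq> D" "\<And>e. e \<in> D - K \<Longrightarrow> l e = u e" "\<And>e. e \<in> D \<Longrightarrow> l e \<le> u e"
      "\<And>U. 0 \<le> cut_slack D l u U" for K and l u :: "'v \<times> 'v \<Rightarrow> 'c"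
    using that
  proof (induction K arbitrary: l u rule: finite_induct)
    case empty
    have "cut_slack D l l U = cut_slack D l u U" for U
      unfolding cut_slack_def by (rule sum.cong) (use empty in auto)
    then show ?case using empty by (intro exI[of _ l]) auto
  next
    case (insert e K)
    then have e: "e \<in> D" by auto
    obtain c where c: "l e \<le> c" "c \<le> u e"
        "\<And>U. 0 \<le> cut_slack D (l(e := c)) (u(e := c)) U"
      using cut_slack_fix_arc[OF fin e, of l u] insert.prems by blast
    have "\<exists>f. (\<forall>d\<in>D. (l(e := c)) d \<le> f d \<and> f d \<le> (u(e := c)) d) \<and>
        (\<forall>U. 0 \<le> cut_slack D f f U)"
    proof (rule insert.IH)
      show "0 \<le> cut_slack D (l(e := c)) (u(e := c)) U" for U by (rule c(3))
    qed (use insert.prems in auto)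
    then obtain f where f: "\<forall>d\<in>D. (l(e := c)) d \<le> f d \<and> f d \<le> (u(e := c)) d"
        "\<forall>U. 0 \<le> cut_slack D f f U" by blast
    have "l d \<le> f d \<and> f d \<le> u d" if "d \<in> D" for d
      using bspec[OF f(1) that] c by (cases "d = e") auto
    then show ?case using f(2) by blast
  qed
  from this[of D l u] obtain f where f: "\<forall>e\<in>D. l e \<le> f e \<and> f e \<le> u e"
      "\<And>U. 0 \<le> cut_slack D f f U"
    using assms by auto
  have "(\<Sum>e | e \<in> D \<and> fst e = v. f e) = (\<Sum>e | e \<in> D \<and> snd e = v. f e)" for v
  proof -
    \<comment> \<open>Net outflow changes sign under complement, so nonnegativity on
      \<open>{v}\<close> and on its complement forces conservation at \<open>v\<close>.\<close>
    have "cut_slack D f f (- {v}) = - cut_slack D f f {v}"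
      unfolding cut_slack_def sum_negf[symmetric] by (rule sum.cong) auto
    then have "cut_slack D f f {v} = 0" using f(2)[of "{v}"] f(2)[of "- {v}"] by simp
    moreover have "cut_slack D f f {v} =
        (\<Sum>e\<in>D. (if fst e = v then f e else 0) - (if snd e = v then f e else 0))"
      unfolding cut_slack_def by (rule sum.cong) auto
    ultimately have "(\<Sum>e\<in>D. if fst e = v then f e else 0) = (\<Sum>e\<in>D. if snd e = v then f e else 0)"
      by (simp add: sum_subtractf)
    then show ?thesis by (simp add: sum.inter_filter[OF fin])
  qed
  then show ?thesis using f(1) by blast
qed


section \<open>Degree-bounded edge weightings of bipartite graphs\<close>

lemma bipartition_commute: "bipartition V E A B \<Longrightarrow> bipartition V E B A"
  unfolding bipartition_def by (metis inf_commute insert_commute sup_commute)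

lemma bipartition_edgeE:
  assumes "bipartition V E A B" "e \<in> E"
  obtains a b where "a \<in> A" "b \<in> B" "e = {a, b}"
  using assms unfolding bipartition_def by blast

lemma fin_graph_finite_edges: "fin_graph V E \<Longrightarrow> finite E"
  unfolding fin_graph_def by (rule finite_subset[of _ "Pow V"]) auto

lemma edges_between_commute: "edges_between E X Y = edges_between E Y X"
  unfolding edges_between_def by (metis insert_commute)

lemma sum_star_bipartition:
  assumes bp: "bipartition V E A B" and fin: "finite B" and a: "a \<in> A"
  shows "(\<Sum>e | e \<in> E \<and> a \<in> e. f e) = (\<Sum>b\<in>B. if {a, b} \<in> E then f {a, b} else 0)"
proof -
  have dis: "A \<inter> B = {}" using bp by (simp add: bipartition_def)
  have "{e. e \<in> E \<and> a \<in> e} = (\<lambda>b. {a, b}) ` {b \<in> B. {a, b} \<in> E}"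
  proof (intro equalityI subsetI)
    fix e assume e: "e \<in> {e. e \<in> E \<and> a \<in> e}"
    then obtain a' b where ab: "a' \<in> A" "b \<in> B" "e = {a', b}"
      using bipartition_edgeE[OF bp] by blast
    then have "a' = a" using e a dis by auto
    then show "e \<in> (\<lambda>b. {a, b}) ` {b \<in> B. {a, b} \<in> E}" using e ab by auto
  qed auto
  moreover have "inj_on (\<lambda>b. {a, b}) {b \<in> B. {a, b} \<in> E}"
    by (auto simp: inj_on_def doubleton_eq_iff)
  ultimately have "(\<Sum>e | e \<in> E \<and> a \<in> e. f e) = (\<Sum>b | b \<in> B \<and> {a, b} \<in> E. f {a, b})"
    by (simp add: sum.reindex)
  then show ?thesis by (simp add: sum.inter_filter[OF fin])
qed

text \<open>Disjointness makes the ordered pair behind each edge unique, so that no edge is counted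
  twice.\<close>

lemma edges_between_eq_sum:
  assumes "finite X" "finite Y" "X \<inter> Y = {}"
  shows "of_nat (edges_between E X Y) = (\<Sum>x\<in>X. \<Sum>y\<in>Y. if {x, y} \<in> E then 1 else 0 :: 'c::semiring_1)"
proof -
  let ?D = "{p \<in> X \<times> Y. {fst p, snd p} \<in> E}"
  have "{e \<in> E. \<exists>x\<in>X. \<exists>y\<in>Y. e = {x, y}} = (\<lambda>p. {fst p, snd p}) ` ?D"
    by (force simp: image_iff)
  moreover have "inj_on (\<lambda>p. {fst p, snd p}) ?D"
    using assms(3) by (auto simp: inj_on_def doubleton_eq_iff)
  ultimately have "edges_between E X Y = card ?D"
    unfolding edges_between_def by (simp add: card_image)
  then have "of_nat (edges_between E X Y) = (\<Sum>p\<in>?D. 1 :: 'c)" by simp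
  also have "\<dots> = (\<Sum>p\<in>X \<times> Y. if {fst p, snd p} \<in> E then 1 else 0)"
    using assms by (simp only: sum.inter_filter finite_cartesian_product)
  also have "\<dots> = (\<Sum>x\<in>X. \<Sum>y\<in>Y. if {x, y} \<in> E then 1 else 0)"
    by (simp add: sum.cartesian_product case_prod_beta)
  finally show ?thesis .
qed

text \<open>The weighting is a circulation that enters each vertex of \<open>A\<close> with amount
  in \<open>[lo, hi]\<close>, crosses edges of capacity 1 to \<open>B\<close>, and returns with
  amount in \<open>[lo, hi]\<close>. The two cut hypotheses are Hoffman's condition for this
  network. Over the integers the weighting selects a subgraph.\<close>

theorem bipartite_bounded_degrees:
  fixes lo hi :: "'c::{linordered_idom, conditionally_complete_linorder}"
  assumes fin: "finite A" "finite B" and bp: "bipartition V E A B" and lohi: "lo \<le> hi"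
    and cutA: "\<And>X Y. X \<subseteq> A \<Longrightarrow> Y \<subseteq> B \<Longrightarrow>
      lo * of_nat (card X) \<le> of_nat (edges_between E X Y) + hi * of_nat (card (B - Y))"
    and cutB: "\<And>X Y. X \<subseteq> A \<Longrightarrow> Y \<subseteq> B \<Longrightarrow>
      lo * of_nat (card Y) \<le> of_nat (edges_between E X Y) + hi * of_nat (card (A - X))"
  obtains z where "\<And>e. e \<in> E \<Longrightarrow> 0 \<le> z e \<and> z e \<le> 1"
    "\<And>v. v \<in> V \<Longrightarrow> lo \<le> (\<Sum>e | e \<in> E \<and> v \<in> e. z e) \<and> (\<Sum>e | e \<in> E \<and> v \<in> e. z e) \<le> hi"
proof -
  have dis: "A \<inter> B = {}" and V: "V = A \<union> B" using bp by (auto simp: bipartition_def)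
  \<comment> \<open>\<^term>\<open>None\<close> is source and sink at once, so that flows become circulations.\<close>
  define DA where "DA = (\<lambda>a. (None :: 'a option, Some a)) ` A"
  define DB where "DB = (\<lambda>b. (Some b, None :: 'a option)) ` B"
  \<comment> \<open>All pairs are arcs and non-edges get capacity 0, so that flow sums run over full
    rectangles.\<close>
  define DE where "DE = (\<lambda>(a, b). (Some a, Some b)) ` (A \<times> B)"
  define D where "D = DA \<union> DE \<union> DB"
  define l :: "'a option \<times> 'a option \<Rightarrow> 'c" where
    "l = (\<lambda>(p, q). if p = None \<or> q = None then lo else 0)"
  define u :: "'a option \<times> 'a option \<Rightarrow> 'c" where
    "u = (\<lambda>(p, q). if p = None \<or> q = None then hi
                   else if {the p, the q} \<in> E then 1 else 0)"
  have finD: "finite D" unfolding D_def DA_def DB_def DE_def using fin by auto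
  have sumD: "(\<Sum>e\<in>D. g e) = (\<Sum>a\<in>A. g (None, Some a))
      + (\<Sum>a\<in>A. \<Sum>b\<in>B. g (Some a, Some b)) + (\<Sum>b\<in>B. g (Some b, None))"
    for g :: "'a option \<times> 'a option \<Rightarrow> 'c"
  proof -
    have "sum g D = sum g DA + sum g DE + sum g DB"
      unfolding D_def using fin
      by (subst sum.union_disjoint; (subst sum.union_disjoint)?)
        (auto simp: DA_def DE_def DB_def)
    moreover have "sum g DA = (\<Sum>a\<in>A. g (None, Some a))"
      unfolding DA_def by (subst sum.reindex) (auto simp: inj_on_def)
    moreover have "sum g DB = (\<Sum>b\<in>B. g (Some b, None))"
      unfolding DB_def by (subst sum.reindex) (auto simp: inj_on_def)
    moreover have "sum g DE = (\<Sum>a\<in>A. \<Sum>b\<in>B. g (Some a, Some b))"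
      unfolding DE_def
      by (subst sum.reindex) (auto simp: inj_on_def sum.cartesian_product case_prod_beta)
    ultimately show ?thesis by simp
  qed
  have const: "(\<Sum>x\<in>S. if x \<in> S' then c else 0) = c * of_nat (card (S \<inter> S'))"
    if "finite S" for S S' :: "'a set" and c :: 'c
    using that by (simp add: sum.If_cases mult.commute)
  have rect: "(\<Sum>a\<in>A. \<Sum>b\<in>B. if a \<in> X \<and> b \<in> Y \<and> {a, b} \<in> E then 1 else 0)
      = (of_nat (edges_between E X Y) :: 'c)" if "X \<subseteq> A" "Y \<subseteq> B" for X Y
  proof -
    have "(\<Sum>a\<in>A. \<Sum>b\<in>B. if a \<in> X \<and> b \<in> Y \<and> {a, b} \<in> E then 1 else 0 :: 'c)
        = (\<Sum>a\<in>X. \<Sum>b\<in>B. if a \<in> X \<and> b \<in> Y \<and> {a, b} \<in> E then 1 else 0)"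
      using that fin by (intro sum.mono_neutral_right) auto
    also have "\<dots> = (\<Sum>a\<in>X. \<Sum>b\<in>Y. if {a, b} \<in> E then 1 else 0)"
      using that fin by (intro sum.cong sum.mono_neutral_cong_right) auto
    also have "\<dots> = of_nat (edges_between E X Y)"
      using that fin dis by (intro edges_between_eq_sum[symmetric]) (auto intro: finite_subset)
    finally show ?thesis .
  qed
  have cut: "0 \<le> cut_slack D l u U" for U
  proof -
    \<comment> \<open>With \<open>X = A \<inter> T\<close> and \<open>Y = B - T\<close>, the edges
      leaving \<open>U\<close> are those between \<open>X\<close> and \<open>Y\<close>, and edges
      entering \<open>U\<close> cost nothing. If \<open>None\<close> is outside \<open>U\<close>,
      the arcs into \<open>X\<close> enter and those out of \<open>B - Y\<close> leave, which gives
      \<open>cutA\<close>; otherwise the arcs into \<open>A - X\<close> leave and those out of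
      \<open>Y\<close> enter, which gives \<open>cutB\<close>.\<close>
    define T where "T = Some -` U"
    have T: "Some x \<in> U \<longleftrightarrow> x \<in> T" for x by (simp add: T_def)
    show ?thesis
    proof (cases "None \<in> U")
      case False
      have "cut_slack D l u U = (\<Sum>a\<in>A. if a \<in> T then - lo else 0)
        + (\<Sum>a\<in>A. \<Sum>b\<in>B. if a \<in> A \<inter> T \<and> b \<in> B - T \<and> {a, b} \<in> E then 1 else 0)
        + (\<Sum>b\<in>B. if b \<in> T then hi else 0)"
        unfolding cut_slack_def sumD
        by (intro arg_cong2[where f = "(+)"] sum.cong) (use False in \<open>auto simp: l_def u_def T\<close>)
      also have "\<dots> = - lo * of_nat (card (A \<inter> T)) + of_nat (edges_between E (A \<inter> T) (B - T))
          + hi * of_nat (card (B \<inter> T))"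
        using fin by (subst rect) (auto simp: const)
      finally show ?thesis
        using cutA[of "A \<inter> T" "B - T"] by (simp add: Diff_Diff_Int)
    next
      case True
      have "cut_slack D l u U = (\<Sum>a\<in>A. if a \<in> - T then hi else 0)
        + (\<Sum>a\<in>A. \<Sum>b\<in>B. if a \<in> A \<inter> T \<and> b \<in> B - T \<and> {a, b} \<in> E then 1 else 0)
        + (\<Sum>b\<in>B. if b \<in> - T then - lo else 0)"
        unfolding cut_slack_def sumD
        by (intro arg_cong2[where f = "(+)"] sum.cong) (use True in \<open>auto simp: l_def u_def T\<close>)
      also have "\<dots> = hi * of_nat (card (A - T)) + of_nat (edges_between E (A \<inter> T) (B - T))
          - lo * of_nat (card (B - T))"
        unfolding const[OF fin(1)] const[OF fin(2)] by (subst rect) (auto simp: Diff_eq)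
      finally show ?thesis
        using cutB[of "A \<inter> T" "B - T"] by (simp add: Diff_Int)
    qed
  qed
  have "l e \<le> u e" for e using lohi by (auto simp: l_def u_def split: prod.split)
  then obtain f where f: "\<And>e. e \<in> D \<Longrightarrow> l e \<le> f e \<and> f e \<le> u e"
      and cons: "\<And>v. (\<Sum>e | e \<in> D \<and> fst e = v. f e) = (\<Sum>e | e \<in> D \<and> snd e = v. f e)"
    using hoffman_circulation[OF finD, of l u] cut by blast
  have cons': "(\<Sum>e\<in>D. if fst e = v then f e else 0) = (\<Sum>e\<in>D. if snd e = v then f e else 0)" for v
    using cons[of v] by (simp add: sum.inter_filter[OF finD])
  \<comment> \<open>An edge has exactly one end on each side, so intersecting with \<open>A\<close>
    and \<open>B\<close> recovers its orientation.\<close>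
  define z where "z e = f (Some (the_elem (e \<inter> A)), Some (the_elem (e \<inter> B)))" for e
  have z: "z {a, b} = f (Some a, Some b)" if "a \<in> A" "b \<in> B" for a b
  proof -
    have "{a, b} \<inter> A = {a}" "{a, b} \<inter> B = {b}" using that dis by auto
    then show ?thesis by (simp add: z_def)
  qed
  have fE: "l (Some a, Some b) \<le> f (Some a, Some b) \<and> f (Some a, Some b) \<le> u (Some a, Some b)"
    if "a \<in> A" "b \<in> B" for a b
    using that by (intro f) (auto simp: D_def DE_def)
  have ext: "(if {a, b} \<in> E then z {a, b} else 0) = f (Some a, Some b)"
    if "a \<in> A" "b \<in> B" for a b
    using fE[OF that] z[OF that] by (auto simp: l_def u_def)
  show ?thesis
  proof
    fix e assume e: "e \<in> E"
    then obtain a b where "a \<in> A" "b \<in> B" "e = {a, b}" using bipartition_edgeE[OF bp] by blast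
    then show "0 \<le> z e \<and> z e \<le> 1" using fE[of a b] z[of a b] e by (auto simp: l_def u_def)
  next
    fix v assume "v \<in> V"
    then consider "v \<in> A" | "v \<in> B" using V by auto
    then show "lo \<le> (\<Sum>e | e \<in> E \<and> v \<in> e. z e) \<and> (\<Sum>e | e \<in> E \<and> v \<in> e. z e) \<le> hi"
    proof cases
      case 1
      have "(\<Sum>e | e \<in> E \<and> v \<in> e. z e) = (\<Sum>b\<in>B. f (Some v, Some b))"
        unfolding sum_star_bipartition[OF bp fin(2) 1] using 1 ext by (intro sum.cong) auto
      also have "\<dots> = f (None, Some v)"
      proof -
        have v: "v \<notin> B" using 1 dis by auto
        have "(\<Sum>a\<in>A. \<Sum>b\<in>B. if a = v then f (Some a, Some b) else 0)
            = (\<Sum>a\<in>A. if a = v then (\<Sum>b\<in>B. f (Some a, Some b)) else 0)"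
          by (intro sum.cong) auto
        moreover have "(\<Sum>b\<in>B. if b = v then f (Some b, None) else 0) = 0"
          "(\<Sum>a\<in>A. \<Sum>b\<in>B. if b = v then f (Some a, Some b) else 0) = 0"
          using v by (auto intro!: sum.neutral)
        ultimately show ?thesis
          using cons'[of "Some v"] 1 fin unfolding sumD by (simp add: sum.delta)
      qed
      finally show ?thesis using f[of "(None, Some v)"] 1 by (auto simp: D_def DA_def l_def u_def)
    next
      case 2
      have "(\<Sum>e | e \<in> E \<and> v \<in> e. z e) = (\<Sum>a\<in>A. f (Some a, Some v))"
        unfolding sum_star_bipartition[OF bipartition_commute[OF bp] fin(1) 2]
        by (intro sum.cong) (simp_all only: ext[OF _ 2, symmetric] insert_commute)
      also have "\<dots> = f (Some v, None)"
      proof -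
        have v: "v \<notin> A" using 2 dis by auto
        have "(\<Sum>a\<in>A. \<Sum>b\<in>B. if a = v then f (Some a, Some b) else 0) = 0"
          "(\<Sum>a\<in>A. if a = v then f (None, Some a) else 0) = 0"
          using v by (auto intro!: sum.neutral)
        then show ?thesis
          using cons'[of "Some v"] 2 fin unfolding sumD by (simp add: sum.delta)
      qed
      finally show ?thesis using f[of "(Some v, None)"] 2 by (auto simp: D_def DB_def l_def u_def)
    qed
  qed
qed

section \<open>Perfect matchings and weak duality\<close>

text \<open>A perfect matching is an integral weighting of the support with all degrees 1. The cut
  condition follows by double counting: \<open>X\<close> emits weight \<open>t * card X\<close>,
  each support edge into \<open>Y\<close> carries at most \<open>t\<close>, and each vertex outside
  \<open>Y\<close> absorbs at most \<open>t\<close>.\<close>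

lemma perfect_matching_in_support:
  fixes x :: "'a set \<Rightarrow> real"
  assumes G: "fin_graph V E" and bp: "bipartition V E A B"
    and x0: "\<And>e. e \<in> E \<Longrightarrow> 0 \<le> x e" and t: "0 < t"
    and deg: "\<And>v. v \<in> V \<Longrightarrow> (\<Sum>e | e \<in> E \<and> v \<in> e. x e) = t"
  obtains M where "M \<in> perfect_matchings V E" "\<And>e. e \<in> M \<Longrightarrow> 0 < x e"
proof -
  define S where "S = {e \<in> E. 0 < x e}"
  have V: "V = A \<union> B" "A \<inter> B = {}" using bp by (auto simp: bipartition_def)
  have fin: "finite A" "finite B" "finite E"
    using G V fin_graph_finite_edges[OF G] by (auto simp: fin_graph_def)
  have bpS: "bipartition V S A B" using bp by (auto simp: S_def bipartition_def)
  \<comment> \<open>The sides are kept general so that the bound also applies with \<open>A\<close>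
    and \<open>B\<close> exchanged.\<close>
  have cut: "int (card X) \<le> int (edges_between S X Y) + int (card (B' - Y))"
    if bp': "bipartition V E A' B'" and fin': "finite A'" "finite B'"
      and X: "X \<subseteq> A'" and Y: "Y \<subseteq> B'" for X Y A' B'
  proof -
    have V': "V = A' \<union> B'" "A' \<inter> B' = {}" using bp' by (auto simp: bipartition_def)
    have finX: "finite X" "finite Y" using X Y fin' finite_subset by auto
    have dis: "X \<inter> Y = {}" using X Y V' by auto
    define w where "w a b = (if {a, b} \<in> E then x {a, b} else 0)" for a b
    have wc: "w a b = w b a" for a b by (simp only: w_def insert_commute)
    have w0: "0 \<le> w a b" for a b using x0 by (auto simp: w_def)
    have wA: "(\<Sum>b\<in>B'. w a b) = t" if "a \<in> A'" for a
      using sum_star_bipartition[OF bp' fin'(2) that, of x] deg[of a] that V'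
      by (auto simp: w_def)
    have wB: "(\<Sum>a\<in>A'. w a b) = t" if "b \<in> B'" for b
      using sum_star_bipartition[OF bipartition_commute[OF bp'] fin'(1) that, of x] deg[of b] that V'
      unfolding wc[of _ b] by (auto simp: w_def)
    have "t * card X = (\<Sum>a\<in>X. \<Sum>b\<in>B'. w a b)" using wA X by (simp add: subset_iff)
    also have "\<dots> = (\<Sum>a\<in>X. (\<Sum>b\<in>Y. w a b) + (\<Sum>b\<in>B' - Y. w a b))"
      using Y fin' by (intro sum.cong refl) (metis add.commute sum.subset_diff)
    also have "\<dots> = (\<Sum>a\<in>X. \<Sum>b\<in>Y. w a b) + (\<Sum>b\<in>B' - Y. \<Sum>a\<in>X. w a b)"
      by (simp add: sum.distrib sum.swap[of _ X])
    also have "\<dots> \<le> (\<Sum>a\<in>X. \<Sum>b\<in>Y. t * (if {a, b} \<in> S then 1 else 0))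
        + (\<Sum>b\<in>B' - Y. \<Sum>a\<in>A'. w a b)"
    proof (intro add_mono sum_mono)
      fix a b assume ab: "a \<in> X" "b \<in> Y"
      have "w a b \<le> (\<Sum>b\<in>B'. w a b)" using ab Y fin' w0 by (intro member_le_sum) auto
      then have "w a b \<le> t" using wA ab X by auto
      then show "w a b \<le> t * (if {a, b} \<in> S then 1 else 0)"
        using x0[of "{a, b}"] by (auto simp: w_def S_def)
    next
      fix b
      show "(\<Sum>a\<in>X. w a b) \<le> (\<Sum>a\<in>A'. w a b)" using X fin' w0 by (intro sum_mono2) auto
    qed
    also have "\<dots> = t * (\<Sum>a\<in>X. \<Sum>b\<in>Y. if {a, b} \<in> S then 1 else 0) + t * card (B' - Y)"
      using wB by (simp add: sum_distrib_left)
    also have "\<dots> = t * (edges_between S X Y + card (B' - Y))"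
      using edges_between_eq_sum[OF finX dis, of S, where 'c = real] by (simp add: distrib_left)
    finally have "card X \<le> edges_between S X Y + card (B' - Y)" using t by simp
    then show ?thesis by linarith
  qed
  obtain z :: "'a set \<Rightarrow> int" where z01: "\<And>e. e \<in> S \<Longrightarrow> 0 \<le> z e \<and> z e \<le> 1"
    and zdeg: "\<And>v. v \<in> V \<Longrightarrow> 1 \<le> (\<Sum>e | e \<in> S \<and> v \<in> e. z e) \<and> (\<Sum>e | e \<in> S \<and> v \<in> e. z e) \<le> 1"
  proof (rule bipartite_bounded_degrees[OF fin(1,2) bpS, of "1 :: int" 1])
    fix X Y assume XY: "X \<subseteq> A" "Y \<subseteq> B"
    show "1 * int (card X) \<le> int (edges_between S X Y) + 1 * int (card (B - Y))"
      using cut[OF bp fin(1,2) XY] by simp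
    show "1 * int (card Y) \<le> int (edges_between S X Y) + 1 * int (card (A - X))"
      using cut[OF bipartition_commute[OF bp] fin(2,1) XY(2,1)]
      by (simp add: edges_between_commute)
  qed auto
  define M where "M = {e \<in> S. z e = 1}"
  have "\<exists>!e. e \<in> M \<and> v \<in> e" if "v \<in> V" for v
  proof -
    have finS: "finite {e. e \<in> S \<and> v \<in> e}" using fin(3) by (simp add: S_def)
    have "1 = (\<Sum>e | e \<in> S \<and> v \<in> e. z e)" using zdeg[OF that] by simp
    \<comment> \<open>An integer between 0 and 1 is an indicator value, so the degree of
      \<open>v\<close> counts the edges of \<open>M\<close> at \<open>v\<close>.\<close>
    also have "\<dots> = (\<Sum>e | e \<in> S \<and> v \<in> e. if z e = 1 then 1 else 0)"
      using z01 by (intro sum.cong) force+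
    also have "\<dots> = int (card {e. e \<in> M \<and> v \<in> e})"
      unfolding sum.inter_filter[OF finS, symmetric] by (simp add: M_def conj_ac)
    finally have "card {e. e \<in> M \<and> v \<in> e} = 1" by simp
    then obtain d where "{e. e \<in> M \<and> v \<in> e} = {d}" by (rule card_1_singletonE)
    then have "e \<in> M \<and> v \<in> e \<longleftrightarrow> e = d" for e by (metis mem_Collect_eq singleton_iff)
    then show ?thesis by simp
  qed
  moreover have "M \<subseteq> E" "\<And>e. e \<in> M \<Longrightarrow> 0 < x e" by (auto simp: M_def S_def)
  ultimately show ?thesis using that[of M] by (simp add: perfect_matchings_def)
qed

lemma sum_incidence:
  assumes "finite E" "M \<subseteq> E"
  shows "(\<Sum>e\<in>E. incidence M e * f e) = sum f M"
proof -
  have "(\<Sum>e\<in>E. incidence M e * f e) = (\<Sum>e\<in>M. incidence M e * f e)"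
    using assms by (intro sum.mono_neutral_right) (auto simp: incidence_def)
  then show ?thesis by (simp add: incidence_def)
qed

text \<open>Weak duality for fractional packings of perfect matchings: as in Birkhoff's theorem,
  perfect matchings are peeled off the weighting until its support is empty.\<close>

lemma mp_feasible_weight_ge:
  fixes x y :: "'a set \<Rightarrow> real"
  assumes G: "fin_graph V E" and bp: "bipartition V E A B" and ne: "V \<noteq> {}"
    and y: "mp_feasible V E y"
    and x0: "\<And>e. e \<in> E \<Longrightarrow> 0 \<le> x e"
    and deg: "\<And>v. v \<in> V \<Longrightarrow> (\<Sum>e | e \<in> E \<and> v \<in> e. x e) = t"
  shows "t \<le> (\<Sum>e\<in>E. x e * y e)"
  using x0 deg
proof (induction "card {e \<in> E. x e \<noteq> 0}" arbitrary: x t rule: less_induct)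
  case less
  have finE: "finite E" by (rule fin_graph_finite_edges[OF G])
  have y0: "\<And>e. e \<in> E \<Longrightarrow> 0 \<le> y e" using y by (auto simp: mp_feasible_def)
  show ?case
  proof (cases "0 < t")
    case False
    have "0 \<le> (\<Sum>e\<in>E. x e * y e)" using less.prems y0 by (intro sum_nonneg) auto
    then show ?thesis using False by linarith
  next
    case True
    obtain M where M: "M \<in> perfect_matchings V E" "\<And>e. e \<in> M \<Longrightarrow> 0 < x e"
      using perfect_matching_in_support[OF G bp less.prems(1) True less.prems(2)] by blast
    have ME: "M \<subseteq> E" and M1: "\<And>v. v \<in> V \<Longrightarrow> \<exists>!e. e \<in> M \<and> v \<in> e"
      using M by (auto simp: perfect_matchings_def)
    have finM: "finite M" using ME finE finite_subset by blast
    obtain v where "v \<in> V" using ne by blast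
    then have Mne: "M \<noteq> {}" using M1 by blast
    \<comment> \<open>The largest multiple of \<open>M\<close> that can be subtracted while keeping
      the weights nonnegative; it empties the edge \<open>d\<close>, so the support shrinks.\<close>
    define \<epsilon> where "\<epsilon> = Min (x ` M)"
    obtain d where d: "d \<in> M" "x d = \<epsilon>"
      using Min_in[of "x ` M"] finM Mne unfolding \<epsilon>_def by fastforce
    have \<epsilon>: "0 < \<epsilon>" "\<And>e. e \<in> M \<Longrightarrow> \<epsilon> \<le> x e"
      using M(2)[OF d(1)] d(2) finM by (simp_all add: \<epsilon>_def)
    define x' where "x' e = x e - \<epsilon> * incidence M e" for e
    have "t - \<epsilon> \<le> (\<Sum>e\<in>E. x' e * y e)"
    proof (rule less.hyps)
      have "{e \<in> E. x' e \<noteq> 0} \<subseteq> {e \<in> E. x e \<noteq> 0} - {d}"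
        using d by (auto simp: x'_def incidence_def split: if_splits dest: M(2))
      moreover have "d \<in> {e \<in> E. x e \<noteq> 0}" using d ME \<epsilon> by auto
      ultimately show "card {e \<in> E. x' e \<noteq> 0} < card {e \<in> E. x e \<noteq> 0}"
        using finE by (intro psubset_card_mono) auto
      show "0 \<le> x' e" if "e \<in> E" for e
        using less.prems(1)[OF that] \<epsilon> by (auto simp: x'_def incidence_def)
      fix v assume v: "v \<in> V"
      have "(\<Sum>e | e \<in> E \<and> v \<in> e. incidence M e) = (\<Sum>e | e \<in> M \<and> v \<in> e. 1)"
        using finE ME by (intro sum.mono_neutral_cong_right) (auto simp: incidence_def)
      also have "{e. e \<in> M \<and> v \<in> e} = {THE e. e \<in> M \<and> v \<in> e}"
        using theI'[OF M1[OF v]] M1[OF v] by auto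
      finally have "(\<Sum>e | e \<in> E \<and> v \<in> e. incidence M e) = 1" by simp
      then show "(\<Sum>e | e \<in> E \<and> v \<in> e. x' e) = t - \<epsilon>"
        unfolding x'_def by (simp add: sum_subtractf less.prems(2)[OF v] flip: sum_distrib_left)
    qed
    moreover have "(\<Sum>e\<in>E. x' e * y e) =
        (\<Sum>e\<in>E. x e * y e) - \<epsilon> * (\<Sum>e\<in>E. incidence M e * y e)"
      by (simp add: x'_def left_diff_distrib sum_subtractf sum_distrib_left mult.assoc)
    \<comment> \<open>Feasibility of \<open>y\<close> at \<open>M\<close>: the peeled part
      contributes at least the amount by which the degrees dropped.\<close>
    moreover have "\<epsilon> * 1 \<le> \<epsilon> * (\<Sum>e\<in>E. incidence M e * y e)"
      using y M \<epsilon> by (intro mult_left_mono) (auto simp: mp_feasible_def)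
    ultimately show ?thesis by simp
  qed
qed

section \<open>Structure of the Cartesian product\<close>

text \<open>Written as rectangles, product edges reveal by projection which factor edge they
  copy.\<close>

lemma cart_edges_eq:
  assumes "fin_graph V E" "fin_graph W F"
  shows "cart_edges V E W F =
    {e \<times> {h} | e h. e \<in> E \<and> h \<in> W} \<union> {{g} \<times> f | g f. g \<in> V \<and> f \<in> F}" (is "?L = ?R")
proof (intro equalityI subsetI)
  fix s assume "s \<in> ?L"
  then obtain g h g' h' where s: "s = {(g, h), (g', h')}" "g \<in> V" "h \<in> W"
      "g = g' \<and> {h, h'} \<in> F \<or> {g, g'} \<in> E \<and> h = h'"
    unfolding cart_edges_def by auto
  from s(4) show "s \<in> ?R"
  proof
    assume "g = g' \<and> {h, h'} \<in> F"
    then show ?thesis using s by (intro UnI2) (auto intro!: exI[of _ g] exI[of _ "{h, h'}"])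
  next
    assume "{g, g'} \<in> E \<and> h = h'"
    then show ?thesis using s by (intro UnI1) (auto intro!: exI[of _ "{g, g'}"] exI[of _ h])
  qed
next
  fix s assume "s \<in> ?R"
  then consider e h where "s = e \<times> {h}" "e \<in> E" "h \<in> W"
    | g f where "s = {g} \<times> f" "g \<in> V" "f \<in> F" by auto
  then show "s \<in> ?L"
  proof cases
    case 1
    then obtain g g' where "g \<in> V" "g' \<in> V" "e = {g, g'}" using assms(1) unfolding fin_graph_def by blast
    then show ?thesis using 1 unfolding cart_edges_def
      by (intro CollectI exI[of _ g] exI[of _ h] exI[of _ g'] exI[of _ h]) auto
  next
    case 2
    then obtain h h' where "h \<in> W" "h' \<in> W" "f = {h, h'}" using assms(2) unfolding fin_graph_def by blast
    then show ?thesis using 2 unfolding cart_edges_def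
      by (intro CollectI exI[of _ g] exI[of _ h] exI[of _ g] exI[of _ h']) auto
  qed
qed

lemma cart_edges_cases:
  assumes "fin_graph V E" "fin_graph W F" "s \<in> cart_edges V E W F"
  obtains (left) e h where "s = e \<times> {h}" "e \<in> E" "h \<in> W"
  | (right) g f where "s = {g} \<times> f" "g \<in> V" "f \<in> F"
  using assms(3) unfolding cart_edges_eq[OF assms(1,2)] by blast

lemma fin_graph_cart:
  assumes "fin_graph V E" "fin_graph W F"
  shows "fin_graph (V \<times> W) (cart_edges V E W F)"
  unfolding fin_graph_def
proof (intro conjI ballI)
  show "finite (V \<times> W)" using assms by (simp add: fin_graph_def)
  fix s assume "s \<in> cart_edges V E W F"
  then show "\<exists>p\<in>V \<times> W. \<exists>q\<in>V \<times> W. p \<noteq> q \<and> s = {p, q}"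
  proof (cases rule: cart_edges_cases[OF assms, consumes 1, case_names left right])
    case (left e h)
    then obtain g g' where "g \<in> V" "g' \<in> V" "g \<noteq> g'" "e = {g, g'}"
      using assms(1) unfolding fin_graph_def by blast
    then show ?thesis using left by (intro bexI[of _ "(g, h)"] bexI[of _ "(g', h)"]) auto
  next
    case (right g f)
    then obtain h h' where "h \<in> W" "h' \<in> W" "h \<noteq> h'" "f = {h, h'}"
      using assms(2) unfolding fin_graph_def by blast
    then show ?thesis using right by (intro bexI[of _ "(g, h)"] bexI[of _ "(g, h')"]) auto
  qed
qed

text \<open>Vertices are coloured by whether the colours of their two coordinates agree; a product
  edge changes the colour of exactly one coordinate.\<close>

lemma bipartition_cart:
  assumes "fin_graph V E" "fin_graph W F" "bipartition V E A B" "bipartition W F C D"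
  shows "bipartition (V \<times> W) (cart_edges V E W F) (A \<times> C \<union> B \<times> D) (B \<times> C \<union> A \<times> D)"
    (is "bipartition _ _ ?P ?Q")
  unfolding bipartition_def
proof (intro conjI ballI)
  have V: "A \<union> B = V" "A \<inter> B = {}" and W: "C \<union> D = W" "C \<inter> D = {}"
    using assms(3,4) by (auto simp: bipartition_def)
  show "?P \<union> ?Q = V \<times> W" "?P \<inter> ?Q = {}" using V W by auto
  fix s assume "s \<in> cart_edges V E W F"
  then show "\<exists>p\<in>?P. \<exists>q\<in>?Q. s = {p, q}"
  proof (cases rule: cart_edges_cases[OF assms(1,2), consumes 1, case_names left right])
    case (left e h)
    obtain a b where ab: "a \<in> A" "b \<in> B" "e = {a, b}"
      using bipartition_edgeE[OF assms(3) left(2)] by blast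
    from left(3) consider "h \<in> C" | "h \<in> D" using W by auto
    then show ?thesis
    proof cases
      case 1
      then show ?thesis using left ab by (intro bexI[of _ "(a, h)"] bexI[of _ "(b, h)"]) auto
    next
      case 2
      then show ?thesis using left ab by (intro bexI[of _ "(b, h)"] bexI[of _ "(a, h)"]) auto
    qed
  next
    case (right g f)
    obtain c d where cd: "c \<in> C" "d \<in> D" "f = {c, d}"
      using bipartition_edgeE[OF assms(4) right(3)] by blast
    from right(2) consider "g \<in> A" | "g \<in> B" using V by auto
    then show ?thesis
    proof cases
      case 1
      then show ?thesis using right cd by (intro bexI[of _ "(g, c)"] bexI[of _ "(g, d)"]) auto
    next
      case 2
      then show ?thesis using right cd by (intro bexI[of _ "(g, d)"] bexI[of _ "(g, c)"]) auto
    qed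
  qed
qed

lemma fin_graph_edge_not_singleton:
  assumes "fin_graph V E" "e \<in> E"
  shows "e \<noteq> {v}"
  using assms unfolding fin_graph_def by (metis doubleton_eq_iff insert_absorb2)

lemma sum_star_cart:
  assumes G: "fin_graph V E" and H: "fin_graph W F" and g: "g \<in> V" and h: "h \<in> W"
  shows "(\<Sum>s | s \<in> cart_edges V E W F \<and> (g, h) \<in> s. x s) =
    (\<Sum>e | e \<in> E \<and> g \<in> e. x (e \<times> {h})) + (\<Sum>f | f \<in> F \<and> h \<in> f. x ({g} \<times> f))"
proof -
  let ?E = "{e. e \<in> E \<and> g \<in> e}" and ?F = "{f. f \<in> F \<and> h \<in> f}"
  have fin: "finite ?E" "finite ?F"
    using fin_graph_finite_edges[OF G] fin_graph_finite_edges[OF H] by auto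
  have "{s. s \<in> cart_edges V E W F \<and> (g, h) \<in> s} =
      (\<lambda>e. e \<times> {h}) ` ?E \<union> (\<lambda>f. {g} \<times> f) ` ?F"
    unfolding cart_edges_eq[OF G H] using g h by auto
  moreover have "(\<lambda>e. e \<times> {h}) ` ?E \<inter> (\<lambda>f. {g} \<times> f) ` ?F = {}"
  proof -
    \<comment> \<open>Equality would make \<open>e\<close> the loop at \<open>g\<close>.\<close>
    have False if "e \<in> ?E" "f \<in> ?F" "e \<times> {h} = {g} \<times> f" for e f
    proof -
      have "e = fst ` (e \<times> {h})" by force
      also have "\<dots> = {g}" using that by force
      finally show False using fin_graph_edge_not_singleton[OF G] that by blast
    qed
    then show ?thesis by blast
  qed
  moreover have "inj_on (\<lambda>e. e \<times> {h}) ?E" "inj_on (\<lambda>f. {g} \<times> f) ?F"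
    by (auto simp: inj_on_def times_eq_iff)
  ultimately show ?thesis using fin by (simp add: sum.union_disjoint sum.reindex)
qed

section \<open>Upper and lower bounds for the product\<close>

text \<open>The cut certifying the upper bound lives in a single copy of \<open>G\<close>: the edges from
  \<open>X\<close> to \<open>Y\<close> in the copy at \<open>c\<close>, and all edges leaving that copy from \<open>X\<close>.\<close>

lemma cart_cut_feasible:
  assumes G: "fin_graph V E" and H: "fin_graph W F" and bp: "bipartition V E A B"
    and reg: "regular r W F" and c: "c \<in> W" and X: "X \<subseteq> A" and Y: "Y \<subseteq> B"
    and k: "card B < card X + card Y"
  obtains y where "mp_feasible (V \<times> W) (cart_edges V E W F) y"
    "(\<Sum>s\<in>cart_edges V E W F. y s) \<le>
      (real (edges_between E X Y) + real r * real (card X)) / (real (card X) + real (card Y) - real (card B))"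
proof -
  let ?E = "cart_edges V E W F"
  have V: "V = A \<union> B" "A \<inter> B = {}" using bp by (auto simp: bipartition_def)
  have finAB: "finite A" "finite B" using G V by (auto simp: fin_graph_def)
  have fin: "finite X" "finite Y" using X Y finAB finite_subset by auto
  have finE: "finite ?E" using fin_graph_finite_edges[OF fin_graph_cart[OF G H]] .
  \<comment> \<open>Every perfect matching will be shown to meet \<open>S\<close> in at least
    \<open>d\<close> edges, so constant weight \<open>1 / d\<close> on \<open>S\<close> is
    feasible.\<close>
  define d where "d = real (card X) + real (card Y) - real (card B)"
  have d: "0 < d" using k by (simp add: d_def)
  define EXY where "EXY = {e \<in> E. \<exists>x\<in>X. \<exists>y\<in>Y. e = {x, y}}"
  define Fc where "Fc = {f \<in> F. c \<in> f}"
  define S where "S = (\<lambda>e. e \<times> {c}) ` EXY \<union> (\<lambda>(x, f). {x} \<times> f) ` (X \<times> Fc)"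
  have finS: "finite EXY" "finite Fc"
    using fin_graph_finite_edges[OF G] fin_graph_finite_edges[OF H] by (auto simp: EXY_def Fc_def)
  then have fS: "finite S" using fin by (auto simp: S_def)
  have "card S \<le> card EXY + card (X \<times> Fc)"
    unfolding S_def using finS fin
    by (intro order_trans[OF card_Un_le] add_mono card_image_le) auto
  also have "\<dots> = edges_between E X Y + r * card X"
    using reg c by (simp add: edges_between_def EXY_def Fc_def regular_def card_cartesian_product)
  finally have cardS: "card S \<le> edges_between E X Y + r * card X" .
  define y where "y s = (if s \<in> S then 1 / d else 0)" for s
  have sumy: "sum y T = real (card (T \<inter> S)) / d" if "finite T" for T
    using that by (simp add: y_def sum.If_cases)
  show ?thesis
  proof
    have "card (?E \<inter> S) \<le> card S" using fS by (intro card_mono) auto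
    then have "real (card (?E \<inter> S)) \<le> real (edges_between E X Y) + real r * real (card X)"
      using cardS by (metis (no_types) le_trans of_nat_add of_nat_le_iff of_nat_mult)
    then show "sum y ?E \<le> (real (edges_between E X Y) + real r * real (card X))
        / (real (card X) + real (card Y) - real (card B))"
      using d finE by (simp add: sumy divide_right_mono flip: d_def)
    have "1 \<le> (\<Sum>s\<in>?E. incidence M s * y s)" if M: "M \<in> perfect_matchings (V \<times> W) ?E" for M
    proof -
      have ME: "M \<subseteq> ?E" and M1: "\<And>v. v \<in> V \<times> W \<Longrightarrow> \<exists>!s. s \<in> M \<and> v \<in> s"
        using M unfolding perfect_matchings_def by blast+
      have finM: "finite M" using ME finE finite_subset by blast
      have XV: "(x, c) \<in> V \<times> W" if "x \<in> X" for x using that X V c by auto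
      define \<mu> where "\<mu> x = (THE s. s \<in> M \<and> (x, c) \<in> s)" for x
      have \<mu>: "\<mu> x \<in> M" "(x, c) \<in> \<mu> x" if "x \<in> X" for x
        using theI'[OF M1[OF XV[OF that]]] unfolding \<mu>_def by auto
      have shape: "(\<exists>b\<in>B. \<mu> x = {x, b} \<times> {c} \<and> {x, b} \<in> E) \<or> (\<exists>f\<in>Fc. \<mu> x = {x} \<times> f)" if x: "x \<in> X" for x
      proof -
        have "\<mu> x \<in> ?E" using \<mu>(1)[OF x] ME by blast
        then show ?thesis
        proof (cases rule: cart_edges_cases[OF G H, consumes 1, case_names left right])
          case (left e h)
          obtain a b where "a \<in> A" "b \<in> B" "e = {a, b}" using bipartition_edgeE[OF bp left(2)] .
          moreover have "h = c" "x \<in> e" using \<mu>(2)[OF x] left by auto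
          moreover have "x \<notin> B" using x X V by auto
          ultimately show ?thesis using left by blast
        next
          case (right g f)
          then show ?thesis using \<mu>(2)[OF x] by (auto simp: Fc_def)
        qed
      qed
      \<comment> \<open>A vertex of \<open>X\<close> whose matching edge avoids \<open>S\<close> is
        matched inside the copy at \<open>c\<close> to a vertex of \<open>B - Y\<close>. Distinct
        ones have distinct partners, so at most \<open>card B - card Y\<close> are bad.\<close>
      define bad where "bad = {x \<in> X. \<mu> x \<notin> S}"
      have "\<exists>b\<in>B - Y. \<mu> x = {x, b} \<times> {c}" if "x \<in> bad" for x
      proof -
        have x: "x \<in> X" "\<mu> x \<notin> S" using that by (auto simp: bad_def)
        then have "\<not> (\<exists>f\<in>Fc. \<mu> x = {x} \<times> f)" by (auto simp: S_def)
        then obtain b where b: "b \<in> B" "\<mu> x = {x, b} \<times> {c}" "{x, b} \<in> E" using shape[OF x(1)] by blast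
        then have "b \<notin> Y" using x unfolding S_def EXY_def by blast
        then show ?thesis using b by blast
      qed
      then obtain \<beta> where \<beta>: "\<And>x. x \<in> bad \<Longrightarrow> \<beta> x \<in> B - Y \<and> \<mu> x = {x, \<beta> x} \<times> {c}" by metis
      have "inj_on \<beta> bad"
      proof (rule inj_onI)
        fix x x' assume xx: "x \<in> bad" "x' \<in> bad" "\<beta> x = \<beta> x'"
        have "(\<beta> x, c) \<in> V \<times> W" using \<beta>[OF xx(1)] V c by auto
        moreover have "(\<beta> x, c) \<in> \<mu> x" "(\<beta> x, c) \<in> \<mu> x'" using \<beta> xx by auto
        moreover have "\<mu> x \<in> M" "\<mu> x' \<in> M" using \<mu> xx by (auto simp: bad_def)
        ultimately have "\<mu> x = \<mu> x'" using M1 by blast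
        then have "(x, c) \<in> {x', \<beta> x'} \<times> {c}" using \<beta>[OF xx(2)] \<mu>(2)[of x] xx(1) by (auto simp: bad_def)
        moreover have "x \<notin> B" using xx(1) X V by (auto simp: bad_def)
        ultimately show "x = x'" using \<beta>[OF xx(2)] by auto
      qed
      then have "card bad \<le> card (B - Y)"
        using \<beta> finAB by (intro card_inj_on_le) auto
      also have "\<dots> = card B - card Y" using Y fin by (simp add: card_Diff_subset)
      finally have bad: "card bad \<le> card B - card Y" .
      \<comment> \<open>No product edge contains two vertices of the copy of \<open>A\<close> at
        \<open>c\<close>, so the other vertices of \<open>X\<close> supply distinct edges of
        \<open>M \<inter> S\<close>.\<close>
      have "inj_on \<mu> (X - bad)"
      proof (rule inj_onI)
        fix x x' assume xx: "x \<in> X - bad" "x' \<in> X - bad" "\<mu> x = \<mu> x'"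
        then have "(x', c) \<in> \<mu> x" using \<mu>(2)[of x'] by auto
        moreover have "x' \<notin> B" using xx(2) X V by auto
        ultimately show "x = x'" using shape[of x] xx(1) by auto
      qed
      moreover have "\<mu> ` (X - bad) \<subseteq> M \<inter> S" using \<mu> by (auto simp: bad_def)
      ultimately have "card (X - bad) \<le> card (M \<inter> S)"
        using finM by (intro card_inj_on_le) auto
      moreover have "card (X - bad) = card X - card bad" "card bad \<le> card X"
        using fin by (auto simp: bad_def card_Diff_subset intro: card_mono)
      moreover have "card Y \<le> card B" using Y finAB by (intro card_mono)
      ultimately have "card X + card Y \<le> card (M \<inter> S) + card B" using bad by linarith
      then have "d \<le> card (M \<inter> S)" by (simp add: d_def)
      then show ?thesis
        using d by (simp add: sum_incidence[OF finE ME] sumy[OF finM])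
    qed
    then show "mp_feasible (V \<times> W) ?E y"
      using d by (auto simp: mp_feasible_def y_def)
  qed
qed

text \<open>The weighting uses one weight per edge of \<open>G\<close> in all copies of \<open>G\<close>, and one weight
  per vertex \<open>g\<close> on the whole copy of \<open>H\<close> over \<open>g\<close>. The latter can correct the degree at \<open>g\<close>
  by any amount between 0 and \<open>r\<close>, so degrees between \<open>t - r\<close> and \<open>t\<close> in \<open>G\<close> suffice.\<close>

lemma cart_feasible_ge:
  assumes G: "fin_graph V E" and H: "fin_graph W F" and ne: "V \<noteq> {}" "W \<noteq> {}"
    and bp: "bipartition V E A B" and AB: "card A = card B"
    and bpH: "bipartite W F" and reg: "regular r W F"
    and t0: "0 \<le> t"
    and t: "\<And>X Y. X \<subseteq> A \<Longrightarrow> Y \<subseteq> B \<Longrightarrow> card A < card X + card Y \<Longrightarrow>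
      t * (real (card X) + real (card Y) - real (card A))
        \<le> real (edges_between E X Y) + real r * real (min (card X) (card Y))"
    and y: "mp_feasible (V \<times> W) (cart_edges V E W F) y"
  shows "t \<le> (\<Sum>s\<in>cart_edges V E W F. y s)"
proof -
  let ?E = "cart_edges V E W F"
  have V: "V = A \<union> B" "A \<inter> B = {}" using bp by (auto simp: bipartition_def)
  have fin: "finite A" "finite B" using G V by (auto simp: fin_graph_def)
  \<comment> \<open>Outside the range of the formula the left side is at most 0, so the bound
    extends to all \<open>X\<close> and \<open>Y\<close>.\<close>
  have cut: "t * (real (card X) + real (card Y) - real (card A))
        \<le> real (edges_between E X Y) + real r * real (min (card X) (card Y))"
    if "X \<subseteq> A" "Y \<subseteq> B" for X Y
  proof (cases "card A < card X + card Y")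
    case False
    then have "t * (real (card X) + real (card Y) - real (card A)) \<le> 0"
      using t0 by (intro mult_nonneg_nonpos) auto
    also have "0 \<le> real (edges_between E X Y) + real r * real (min (card X) (card Y))" by simp
    finally show ?thesis .
  qed (use t that in blast)
  obtain z :: "'a set \<Rightarrow> real" where z01: "\<And>e. e \<in> E \<Longrightarrow> 0 \<le> z e \<and> z e \<le> 1"
    and zdeg: "\<And>v. v \<in> V \<Longrightarrow> t - real r \<le> (\<Sum>e | e \<in> E \<and> v \<in> e. z e) \<and> (\<Sum>e | e \<in> E \<and> v \<in> e. z e) \<le> t"
  proof (rule bipartite_bounded_degrees[OF fin bp, of "t - real r" t])
    fix X Y assume XY: "X \<subseteq> A" "Y \<subseteq> B"
    have co: "real (card (B - Y)) = real (card A) - real (card Y)"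
      "real (card (A - X)) = real (card A) - real (card X)"
      using XY fin AB card_mono[OF fin(1) XY(1)] card_mono[OF fin(2) XY(2)]
      by (auto simp: card_Diff_subset finite_subset of_nat_diff)
    \<comment> \<open>After rearranging, the two Hoffman conditions have \<open>r * card X\<close>
      and \<open>r * card Y\<close> as last term; the bound with the minimum implies both.\<close>
    have "real r * real (min (card X) (card Y)) \<le> real r * real (card X)"
      "real r * real (min (card X) (card Y)) \<le> real r * real (card Y)"
      by (intro mult_left_mono; simp)+
    then show "(t - real r) * real (card X) \<le> real (edges_between E X Y) + t * real (card (B - Y))"
      "(t - real r) * real (card Y) \<le> real (edges_between E X Y) + t * real (card (A - X))"
      unfolding co using cut[OF XY] by (simp_all add: algebra_simps)
  qed auto
  \<comment> \<open>If \<open>r = 0\<close>, the junk value \<open>w g = 0\<close> is right, since the degree at \<open>g\<close> is then already \<open>t\<close>.\<close>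
  define w where "w g = (t - (\<Sum>e | e \<in> E \<and> g \<in> e. z e)) / real r" for g
  have w: "0 \<le> w g" "w g \<le> 1" "(\<Sum>e | e \<in> E \<and> g \<in> e. z e) + real r * w g = t" if "g \<in> V" for g
    using zdeg[OF that] by (cases "r = 0"; simp add: w_def field_simps)+
  \<comment> \<open>The second projection is a singleton exactly for copies of edges of
    \<open>G\<close>, since edges of \<open>H\<close> have two ends.\<close>
  define x where "x s = (if is_singleton (snd ` s) then z (fst ` s) else w (the_elem (fst ` s)))"
    for s :: "('a \<times> 'b) set"
  have xE: "x (e \<times> {h}) = z e" if "e \<in> E" for e h
  proof -
    have "e \<noteq> {}" using G that by (auto simp: fin_graph_def)
    then have "snd ` (e \<times> {h}) = {h}" "fst ` (e \<times> {h}) = e" by force+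
    then show ?thesis by (simp add: x_def)
  qed
  have xF: "x ({g} \<times> f) = w g" if "f \<in> F" for g f
  proof -
    have "f \<noteq> {}" using H that by (auto simp: fin_graph_def)
    then have "snd ` ({g} \<times> f) = f" "fst ` ({g} \<times> f) = {g}" by force+
    moreover have "\<not> is_singleton f"
      using fin_graph_edge_not_singleton[OF H that] by (auto simp: is_singleton_def)
    ultimately show ?thesis by (simp add: x_def)
  qed
  have x01: "0 \<le> x s \<and> x s \<le> 1" if "s \<in> ?E" for s
    using that by (cases rule: cart_edges_cases[OF G H, consumes 1, case_names left right]) (auto simp: xE xF z01 w)
  obtain C D where "bipartition W F C D" using bpH by (auto simp: bipartite_def)
  then have bpc: "bipartition (V \<times> W) ?E (A \<times> C \<union> B \<times> D) (B \<times> C \<union> A \<times> D)"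
    using bipartition_cart G H bp by blast
  have "t \<le> (\<Sum>s\<in>?E. x s * y s)"
  proof (rule mp_feasible_weight_ge[OF fin_graph_cart[OF G H] bpc _ y])
    fix v assume "v \<in> V \<times> W"
    then obtain g h where v: "v = (g, h)" "g \<in> V" "h \<in> W" by auto
    have "(\<Sum>s | s \<in> ?E \<and> (g, h) \<in> s. x s) =
        (\<Sum>e | e \<in> E \<and> g \<in> e. z e) + (\<Sum>f | f \<in> F \<and> h \<in> f. w g)"
      unfolding sum_star_cart[OF G H v(2,3)] by (simp add: xE xF)
    also have "\<dots> = t" using w(3)[OF v(2)] reg v(3) by (simp add: regular_def)
    finally show "(\<Sum>s | s \<in> ?E \<and> v \<in> s. x s) = t" by (simp add: v)
  qed (use ne x01 in auto)
  \<comment> \<open>Weights at most 1 are what turns the weighted bound into one on the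
    objective.\<close>
  also have "\<dots> \<le> (\<Sum>s\<in>?E. y s)"
    using x01 y by (intro sum_mono mult_left_le_one_le) (auto simp: mp_feasible_def)
  finally show ?thesis .
qed

section \<open>The minimum formula\<close>

theorem theorem4p5:
  fixes V A B :: "'a set" and E :: "'a set set"
    and W :: "'b set" and F :: "'b set set" and r :: nat
  assumes "fin_graph V E" and "V \<noteq> {}"
    and "bipartition V E A B" and "card A = card B"
    and "fin_graph W F" and "W \<noteq> {}"
    and "bipartite W F" and "regular r W F"
  shows "mp_f (V \<times> W) (cart_edges V E W F) =
    Min {(real (edges_between E X Y) + real r * real (min (card X) (card Y)))
           / (real (card X) + real (card Y) - real (card A)) | X Y.
         X \<subseteq> A \<and> Y \<subseteq> B \<and> real (card X) + real (card Y) - real (card A) > 0}"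
    (is "_ = Min ?R")
proof -
  note G = assms(1) and bp = assms(3) and AB = assms(4) and H = assms(5)
  let ?q = "\<lambda>X Y. (real (edges_between E X Y) + real r * real (min (card X) (card Y)))
           / (real (card X) + real (card Y) - real (card A))"
  let ?val = "{(\<Sum>s\<in>cart_edges V E W F. y s) | y. mp_feasible (V \<times> W) (cart_edges V E W F) y}"
  have V: "V = A \<union> B" using bp by (auto simp: bipartition_def)
  have fin: "finite A" "finite B" using G V by (auto simp: fin_graph_def)
  have "?R \<subseteq> (\<lambda>(X, Y). ?q X Y) ` (Pow A \<times> Pow B)" by auto
  then have finR: "finite ?R" by (rule finite_subset) (use fin in auto)
  have "0 < card A" using fin AB V assms(2) by (metis Un_empty card_gt_0_iff card_0_eq neq0_conv)
  then have "?q A B \<in> ?R" using AB by (intro CollectI exI[of _ A] exI[of _ B]) auto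
  then have neR: "?R \<noteq> {}" by blast
  have upper: "\<exists>v\<in>?val. v \<le> q" if "q \<in> ?R" for q
  proof -
    obtain X Y where XY: "X \<subseteq> A" "Y \<subseteq> B" "card A < card X + card Y" "q = ?q X Y"
      using \<open>q \<in> ?R\<close> by auto
    obtain c where c: "c \<in> W" using assms(6) by blast
    show ?thesis
    \<comment> \<open>The edges leaving the copy are cut at the smaller of the two sets; the sides
      are exchanged if that is \<open>Y\<close>.\<close>
    proof (cases "card X \<le> card Y")
      case True
      obtain y where "mp_feasible (V \<times> W) (cart_edges V E W F) y"
        "(\<Sum>s\<in>cart_edges V E W F. y s) \<le> (real (edges_between E X Y) + real r * real (card X))
          / (real (card X) + real (card Y) - real (card B))"
        using cart_cut_feasible[OF G H bp assms(8) c XY(1,2)] XY(3) AB by metis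
      then show ?thesis using True XY(4) AB by auto
    next
      case False
      obtain y where "mp_feasible (V \<times> W) (cart_edges V E W F) y"
        "(\<Sum>s\<in>cart_edges V E W F. y s) \<le> (real (edges_between E Y X) + real r * real (card Y))
          / (real (card Y) + real (card X) - real (card A))"
        using cart_cut_feasible[OF G H bipartition_commute[OF bp] assms(8) c XY(2,1)] XY(3) AB
        by (metis add.commute)
      then show ?thesis using False XY(4) by (auto simp: edges_between_commute add.commute min_def)
    qed
  qed
  have lower: "Min ?R \<le> v" if "v \<in> ?val" for v
  proof -
    obtain y where y: "v = (\<Sum>s\<in>cart_edges V E W F. y s)"
      "mp_feasible (V \<times> W) (cart_edges V E W F) y" using \<open>v \<in> ?val\<close> by auto
    show ?thesis unfolding y(1)
    proof (rule cart_feasible_ge[OF G H assms(2,6) bp AB assms(7,8) _ _ y(2)])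
      show "0 \<le> Min ?R" using finR neR by auto
      fix X Y assume XY: "X \<subseteq> A" "Y \<subseteq> B" "card A < card X + card Y"
      then have pos: "0 < real (card X) + real (card Y) - real (card A)" by simp
      have "Min ?R \<le> ?q X Y" using finR XY pos by (intro Min_le) auto
      then show "Min ?R * (real (card X) + real (card Y) - real (card A))
        \<le> real (edges_between E X Y) + real r * real (min (card X) (card Y))"
        using pos by (simp only: pos_le_divide_eq)
    qed
  qed
  \<comment> \<open>The cut attaining the minimum yields a feasible value no larger than it, which
    with \<open>lower\<close> pins down the infimum.\<close>
  obtain v where v: "v \<in> ?val" "v \<le> Min ?R" using upper[OF Min_in[OF finR neR]] by blast
  show ?thesis unfolding mp_f_def
  proof (rule antisym)
    have "bdd_below ?val" using lower by (rule bdd_belowI)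
    then show "Inf ?val \<le> Min ?R" using v by (meson cInf_lower order_trans)
    show "Min ?R \<le> Inf ?val" using v lower by (intro cInf_greatest) auto
  qed
qed

end
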